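(* Let $\mathbf g:\mathcal Z\to\mathcal X$ have disjoint mechanisms and let $\mathbf f:\mathcal X\to\mathcal E$ be a faithful encoder for $\mathbf g$. If a post-hoc transformation $\mathbf M\in\mathbb R^{K\times K}$ of full rank results in disjoint rows in the Jacobian $\mathbf M\mathbf J_{\mathbf f}(\mathbf g(\mathbf z_0))$ for some $\mathbf z_0\in\mathcal Z$, i.e. $|\mathbf M\mathbf J_{\mathbf f}(\mathbf g(\mathbf z_0))|\,|\mathbf M\mathbf J_{\mathbf f}(\mathbf g(\mathbf z_0))|^\top$ is invertible and diagonal for some $\mathbf z_0\in\mathcal Z$, then there are a permutation matrix $\mathbf P\in\mathbb R^{K\times K}$ and an invertible diagonal (scaling) matrix $\mathbf S\in\mathbb R^{K\times K}$ such that, with $\mathbf e=\mathbf f(\mathbf g(\mathbf z))$, one has $\mathbf M\mathbf e=\mathbf P\mathbf S\mathbf z$ for all $\mathbf z\in\mathcal Z$.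
   Context: Setting: $K,L$ are positive integers with $L\gg K$; $\mathcal Z\subset\mathbb R^K$, $\mathcal X\subset\mathbb R^L$, $\mathcal E\subset\mathbb R^K$; $\mathbf g:\mathcal Z\to\mathcal X$ (data-generating process) and $\mathbf f:\mathcal X\to\mathcal E$ (encoder) are maps. $\mathbf J_{\mathbf g}(\mathbf z)\in\mathbb R^{L\times K}$ and $\mathbf J_{\mathbf f}(\mathbf x)\in\mathbb R^{K\times L}$ denote their Jacobian matrices. $|\mathbf A|$ denotes the matrix of element-wise absolute values of $\mathbf A$. A permutation matrix has exactly one entry $1$ in each row and each column and zeros elsewhere. Disjoint mechanisms: $\mathbf g$ is said to generate $\mathbf x=\mathbf g(\mathbf z)$ from its components $\mathbf z$ via disjoint mechanisms if, for all $\mathbf z\in\mathcal Z$, the Jacobian $\mathbf J_{\mathbf g}(\mathbf z)$ exists and is a block matrix, meaning that its columns are non-zero at disjoint rows, i.e. $|\mathbf J_{\mathbf g}(\mathbf z)|^\top|\mathbf J_{\mathbf g}(\mathbf z)|$ is a diagonal $K\times K$ matrix (which may be different for each $\mathbf z$). Faithful encoder: $\mathbf f$ is a faithful encoder for $\mathbf g$ if (i) $\mathbf f(\mathbf g(\mathbf z))=\mathbf D\mathbf z$ for all $\mathbf z\in\mathcal Z$, for some $\mathbf D\in\mathbb R^{K\times K}$ with full rank; and (ii) for all $\mathbf z\in\mathcal Z$, $\mathbf J_{\mathbf f}(\mathbf g(\mathbf z))$ and $\mathbf J_{\mathbf g}(\mathbf z)$ exist and $\operatorname{span}(\mathbf J_{\mathbf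 g}(\mathbf z))^\perp\subseteq\ker(\mathbf J_{\mathbf f}(\mathbf g(\mathbf z)))$, where $\operatorname{span}(\mathbf J_{\mathbf g}(\mathbf z))\subseteq\mathbb R^L$ is the linear span of the columns of $\mathbf J_{\mathbf g}(\mathbf z)$ and $\perp$ denotes the orthogonal complement in $\mathbb R^L$. *)

theory Defs
  imports "HOL-Analysis.Analysis"
begin

text \<open>
  A map \<open>f\<close> defined on \<open>S\<close> has a Jacobian at \<open>x\<close> if it is (Frechet) differentiable there and the
  matrix of the derivative is determined by the values of \<open>f\<close> on \<open>S\<close> near \<open>x\<close>. At interior points of
  \<open>S\<close> this is ordinary differentiability (see below). Boundary points of, say, a closed box are also
  admitted. Uniqueness is part of the notion: at an isolated point of \<open>S\<close>, for example, every matrix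
  is a derivative within \<open>S\<close>, so there is no Jacobian matrix to speak of. Where it exists, the
  Jacobian is \<^term>\<open>jacobian f (at x within S)\<close>, whose entry at row \<open>i\<close> and column \<open>j\<close> is the
  derivative of the \<open>i\<close>-th output with respect to the \<open>j\<close>-th input.
\<close>

definition has_jacobian_at :: "(real^'n \<Rightarrow> real^'m) \<Rightarrow> (real^'n) set \<Rightarrow> real^'n \<Rightarrow> bool" where
  "has_jacobian_at f S x \<longleftrightarrow>
     x \<in> S \<and> (\<exists>!J :: real^'n^'m. (f has_derivative (\<lambda>h. J *v h)) (at x within S))"

lemma has_jacobian_at_jacobian:
  fixes f :: "real^'n \<Rightarrow> real^'m"
  assumes "has_jacobian_at f S x"
  shows "(f has_derivative (\<lambda>h. J *v h)) (at x within S) \<longleftrightarrow> J = jacobian f (at x within S)"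
  using assms jacobian_works[of f "at x within S"]
  unfolding has_jacobian_at_def differentiable_def by blast

lemma has_jacobian_at_interior:
  fixes f :: "real^'n \<Rightarrow> real^'m"
  assumes "x \<in> interior S"
  shows "has_jacobian_at f S x \<longleftrightarrow> f differentiable (at x)"
    and "jacobian f (at x within S) = jacobian f (at x)"
proof -
  have w: "at x within S = at x"
    using assms by (rule at_within_interior)
  show "jacobian f (at x within S) = jacobian f (at x)"
    by (simp add: w)
  have "A = B" if "(f has_derivative (\<lambda>h. A *v h)) (at x)"
    and "(f has_derivative (\<lambda>h. B *v h)) (at x)" for A B :: "real^'n^'m"
    using has_derivative_unique[OF that] by (metis matrix_eq)
  moreover have "x \<in> S"
    using assms interior_subset by blast
  ultimately show "has_jacobian_at f S x \<longleftrightarrow> f differentiable (at x)"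
    unfolding has_jacobian_at_def w
    using jacobian_works[of f "at x"] differentiable_def by blast
qed

text \<open>The library's absolute value on vectors acts componentwise, hence entrywise on matrices:\<close>

lemma abs_matrix_nth: "\<bar>A :: real^'n^'m\<bar> $ i $ j = \<bar>A $ i $ j\<bar>"
  by (simp add: abs_vec_def)

definition diagonal_matrix :: "real^'n^'n \<Rightarrow> bool" where
  "diagonal_matrix A \<longleftrightarrow> (\<forall>i j. i \<noteq> j \<longrightarrow> A $ i $ j = 0)"

definition permutation_matrix :: "real^'n^'n \<Rightarrow> bool" where
  "permutation_matrix P \<longleftrightarrow>
     (\<forall>i j. P $ i $ j = 0 \<or> P $ i $ j = 1) \<and>
     (\<forall>i. \<exists>!j. P $ i $ j = 1) \<and>
     (\<forall>j. \<exists>!i. P $ i $ j = 1)"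

definition disjoint_mechanisms :: "(real^'k) set \<Rightarrow> (real^'k \<Rightarrow> real^'l) \<Rightarrow> bool" where
  "disjoint_mechanisms Z g \<longleftrightarrow>
     (\<forall>z\<in>Z. has_jacobian_at g Z z \<and>
        diagonal_matrix
          (transpose \<bar>jacobian g (at z within Z)\<bar> ** \<bar>jacobian g (at z within Z)\<bar>))"

definition faithful_encoder ::
    "(real^'k) set \<Rightarrow> (real^'l) set \<Rightarrow> (real^'k \<Rightarrow> real^'l) \<Rightarrow> (real^'l \<Rightarrow> real^'k) \<Rightarrow> bool" where
  "faithful_encoder Z X g f \<longleftrightarrow>
     (\<exists>D :: real^'k^'k. rank D = CARD('k) \<and> (\<forall>z\<in>Z. f (g z) = D *v z)) \<and>
     (\<forall>z\<in>Z. has_jacobian_at f X (g z) \<and> has_jacobian_at g Z z \<and>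
        (span (columns (jacobian g (at z within Z))))\<^sup>\<bottom>
          \<subseteq> {v. jacobian f (at (g z) within X) *v v = 0})"

end

theory Submission
  imports Defs
begin

text \<open>
  Write \<open>G\<close> and \<open>R\<close> for the Jacobian of \<open>g\<close> at \<open>z0\<close> and for \<open>M\<close> times the Jacobian of \<open>f\<close> at
  \<open>g z0\<close>. With \<open>f (g z) = D *v z\<close>, the chain rule gives
  \<open>R ** G = M ** D\<close>. Faithfulness puts the rows of \<open>R\<close> into the column
  space of \<open>G\<close>, i.e. \<open>R = C ** transpose G\<close>; since the columns of \<open>G\<close> have disjoint supports,
  \<open>R $ i $ l = C $ i $ j * G $ l $ j\<close> whenever \<open>G $ l $ j \<noteq> 0\<close>. Hence disjointness of the
  rows of \<open>R\<close> forces the rows of \<open>C\<close>, and then those of the invertible matrix \<open>M ** D\<close>, to have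
  disjoint supports, so that \<open>M ** D\<close> is a permutation matrix times a diagonal matrix.
\<close>

text \<open>Uniqueness depends only on the geometry of \<open>S\<close> at \<open>x\<close>, so the
  Jacobian of one map \<open>g\<close> certifies it for every map \<open>h\<close>. The codomains
  may differ in dimension, which is why a single row of \<open>A - B\<close> is copied into all rows
  of \<open>N\<close>.\<close>

lemma has_jacobian_at_derivative_unique:
  fixes g :: "real^'n \<Rightarrow> real^'m" and A B :: "real^'n^'p"
  assumes "has_jacobian_at g S x"
    and A: "(h has_derivative (\<lambda>v. A *v v)) (at x within S)"
    and B: "(h has_derivative (\<lambda>v. B *v v)) (at x within S)"
  shows "A = B"
proof (rule ccontr)
  assume "A \<noteq> B"
  then obtain i where i: "A $ i \<noteq> B $ i"
    by (metis vec_eq_iff)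
  obtain J :: "real^'n^'m" where J: "(g has_derivative (\<lambda>v. J *v v)) (at x within S)"
    and uniq: "\<And>J'. (g has_derivative (\<lambda>v. J' *v v)) (at x within S) \<Longrightarrow> J' = J"
    using assms(1) unfolding has_jacobian_at_def by blast
  \<comment> \<open>Two derivatives of \<open>h\<close> differ by a derivative of \<open>0\<close>; adding that to \<open>J\<close> breaks uniqueness.\<close>
  define N :: "real^'n^'m" where "N = (\<chi> k. A $ i - B $ i)"
  have N: "N *v v = (\<chi> k. (A *v v - B *v v) $ i)" for v
    by (simp add: N_def vec_eq_iff matrix_vector_mult_def left_diff_distrib sum_subtractf)
  have "((\<lambda>y. h y - h y) has_derivative (\<lambda>v. A *v v - B *v v)) (at x within S)"
    using A B by (rule has_derivative_diff)
  from bounded_linear.has_derivative[OF bounded_linear_vec_nth[of i] this]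
  have "((\<lambda>y. 0) has_derivative (\<lambda>v. (A *v v - B *v v) $ i)) (at x within S)"
    by simp
  moreover have "bounded_linear (\<lambda>c::real. (\<chi> k. c) :: real^'m)"
    by (intro linear_conv_bounded_linear[THEN iffD1] linearI) (simp_all add: vec_eq_iff)
  ultimately have "((\<lambda>y. (\<chi> k. 0) :: real^'m) has_derivative (\<lambda>v. N *v v)) (at x within S)"
    unfolding N by (rule bounded_linear.has_derivative[rotated])
  from has_derivative_add[OF J this]
  have "(g has_derivative (\<lambda>v. (J + N) *v v)) (at x within S)"
    by (simp add: matrix_vector_mult_add_rdistrib flip: zero_vec_def)
  then have "J + N = J" by (rule uniq)
  then show False using i by (simp add: N_def vec_eq_iff)
qed

text \<open>Absolute values rule out cancellation: a sum of nonnegative products vanishes only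
  termwise.\<close>

lemma diagonal_matrix_abs_mult_transpose:
  fixes A :: "real^'n^'m"
  shows "diagonal_matrix (\<bar>A\<bar> ** transpose \<bar>A\<bar>) \<longleftrightarrow>
    (\<forall>i j l. i \<noteq> j \<longrightarrow> A $ i $ l = 0 \<or> A $ j $ l = 0)"
  by (auto simp: diagonal_matrix_def matrix_matrix_mult_def transpose_def abs_matrix_nth
      sum_nonneg_eq_0_iff)

text \<open>The component \<open>b\<close> of a row of \<open>F\<close> orthogonal to the columns of
  \<open>G\<close> lies in the kernel of \<open>F\<close>. Pairing that row with \<open>b\<close>
  gives the squared norm of \<open>b\<close>, so \<open>b = 0\<close> and the row is a combination
  of columns of \<open>G\<close>.\<close>

lemma orthogonal_comp_column_span_subset_ker_imp_factor:
  fixes F :: "real^'n^'m" and G :: "real^'p^'n"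
  assumes "(span (columns G))\<^sup>\<bottom> \<subseteq> {v. F *v v = 0}"
  obtains C :: "real^'p^'m" where "F = C ** transpose G"
proof -
  have "\<exists>c. F $ i = G *v c" for i
  proof -
    obtain a b where a: "a \<in> span (columns G)"
      and b: "\<And>w. w \<in> span (columns G) \<Longrightarrow> orthogonal b w" and ab: "F $ i = a + b"
      using orthogonal_subspace_decomp_exists[of "columns G" "F $ i"] by blast
    have "b \<in> (span (columns G))\<^sup>\<bottom>"
      using b by (auto simp: orthogonal_comp_def orthogonal_commute)
    then have "(F *v b) $ i = 0" using assms by auto
    then have "(a + b) \<bullet> b = 0"
      by (simp add: matrix_vector_mul_component ab)
    moreover have "a \<bullet> b = 0" using b[OF a] by (simp add: orthogonal_def inner_commute)
    ultimately have "b = 0" by (simp add: inner_add_left)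
    moreover have "span (columns G) \<subseteq> range ((*v) G)"
    proof (rule span_minimal)
      show "columns G \<subseteq> range ((*v) G)"
        by (auto simp: columns_def simp flip: matrix_vector_mult_basis)
      show "subspace (range ((*v) G))"
        by (simp add: linear_subspace_image)
    qed
    ultimately show ?thesis using a ab by auto
  qed
  then obtain c where c: "\<And>i. F $ i = G *v c i" by metis
  have "F = (\<chi> i. c i) ** transpose G"
    by (simp add: vec_eq_iff c matrix_vector_mult_def matrix_matrix_mult_def transpose_def mult.commute)
  then show thesis by (rule that)
qed

text \<open>Invertibility excludes zero rows and columns, so each column has exactly one nonzero
  entry, in row \<open>\<sigma> j\<close>, and \<open>\<sigma>\<close> is onto, hence a
  bijection.\<close>

lemma invertible_disjoint_rows_decomp:
  fixes A :: "real^'n^'n"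
  assumes "invertible A" and disj: "\<And>i i' j. i \<noteq> i' \<Longrightarrow> A $ i $ j = 0 \<or> A $ i' $ j = 0"
  obtains P S :: "real^'n^'n"
  where "permutation_matrix P" "diagonal_matrix S" "invertible S" "A = P ** S"
proof -
  obtain B where AB: "A ** B = mat 1" and BA: "B ** A = mat 1"
    using assms(1) unfolding invertible_def by blast
  have col: "\<exists>i. A $ i $ j \<noteq> 0" for j
  proof (rule ccontr)
    assume "\<nexists>i. A $ i $ j \<noteq> 0"
    then have "(B ** A) $ j $ j = 0" by (simp add: matrix_matrix_mult_def)
    then show False by (simp add: BA mat_def)
  qed
  have row: "\<exists>j. A $ i $ j \<noteq> 0" for i
  proof (rule ccontr)
    assume "\<nexists>j. A $ i $ j \<noteq> 0"
    then have "(A ** B) $ i $ i = 0" by (simp add: matrix_matrix_mult_def)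
    then show False by (simp add: AB mat_def)
  qed
  obtain \<sigma> where \<sigma>: "\<And>j. A $ \<sigma> j $ j \<noteq> 0" using col by metis
  have eq: "A $ i $ j \<noteq> 0 \<Longrightarrow> i = \<sigma> j" for i j using disj \<sigma> by metis
  have surj: "surj \<sigma>" using row eq by (metis surj_def)
  have "inj \<sigma>" using finite_UNIV_surj_inj[OF finite surj] .
  \<comment> \<open>\<open>P\<close> maps the \<open>j\<close>-th basis vector to the
    \<open>\<sigma> j\<close>-th; \<open>S\<close> carries the single nonzero entry of each column
    of \<open>A\<close>.\<close>
  define P :: "real^'n^'n" where "P = (\<chi> i j. if i = \<sigma> j then 1 else 0)"
  define S :: "real^'n^'n" where "S = (\<chi> i j. if i = j then A $ \<sigma> j $ j else 0)"
  have A: "A = P ** S"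
  proof -
    have "(P ** S) $ i $ j = P $ i $ j * S $ j $ j" for i j
      by (simp add: matrix_matrix_mult_def S_def if_distrib cong: if_cong)
    then show ?thesis using eq by (auto simp: vec_eq_iff P_def S_def)
  qed
  have "permutation_matrix P"
    using \<open>inj \<sigma>\<close> surj unfolding permutation_matrix_def P_def
    by (auto simp: inj_eq dest: surjD)
  moreover have "diagonal_matrix S" by (simp add: diagonal_matrix_def S_def)
  moreover have "invertible S"
  proof -
    have "det S = (\<Prod>i\<in>UNIV. S $ i $ i)"
      by (rule det_diagonal) (simp add: S_def)
    then show ?thesis using \<sigma> by (simp add: invertible_det_nz S_def)
  qed
  ultimately show thesis using A by (rule that)
qed

lemma disjoint_columns_rows_mult:
  fixes C :: "real^'k^'m" and G :: "real^'k^'l" and R :: "real^'l^'m"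
  assumes R: "R = C ** transpose G"
    and G: "\<And>l j j'. j \<noteq> j' \<Longrightarrow> G $ l $ j = 0 \<or> G $ l $ j' = 0"
    and R_disj: "\<And>i i' l. i \<noteq> i' \<Longrightarrow> R $ i $ l = 0 \<or> R $ i' $ l = 0"
    and "i \<noteq> i'"
  shows "(R ** G) $ i $ j = 0 \<or> (R ** G) $ i' $ j = 0"
proof -
  \<comment> \<open>Row \<open>l\<close> of \<open>G\<close> has its only nonzero entry at
    \<open>j\<close>, so the sum collapses to one term.\<close>
  have entry: "R $ i $ l = C $ i $ j * G $ l $ j" if "G $ l $ j \<noteq> 0" for i l
  proof -
    have "R $ i $ l = (\<Sum>m\<in>UNIV. C $ i $ m * G $ l $ m)"
      by (simp add: R matrix_matrix_mult_def transpose_def)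
    also have "\<dots> = (\<Sum>m\<in>{j}. C $ i $ m * G $ l $ m)"
      using G that by (intro sum.mono_neutral_right) auto
    finally show ?thesis by simp
  qed
  \<comment> \<open>The factor is the squared norm of column \<open>j\<close> of \<open>G\<close>,
    so zeros of \<open>C\<close> carry over to \<open>R ** G\<close>.\<close>
  have prod: "(R ** G) $ i $ j = C $ i $ j * (\<Sum>l\<in>UNIV. (G $ l $ j)\<^sup>2)" for i
    unfolding matrix_matrix_mult_def sum_distrib_left vec_lambda_beta
  proof (intro sum.cong refl)
    fix l
    show "(R $ i $ l) * G $ l $ j = C $ i $ j * (G $ l $ j)\<^sup>2"
      by (cases "G $ l $ j = 0") (simp_all add: entry power2_eq_square)
  qed
  show ?thesis
  proof (cases "\<exists>l. G $ l $ j \<noteq> 0")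
    case True
    then obtain l where "G $ l $ j \<noteq> 0" by blast
    then have "C $ i $ j = 0 \<or> C $ i' $ j = 0"
      using R_disj[OF \<open>i \<noteq> i'\<close>, of l] by (simp add: entry)
    then show ?thesis by (auto simp: prod)
  qed (simp add: prod)
qed

theorem theorem3p3:
  fixes Z :: "(real^'k) set" and X :: "(real^'l) set" and E :: "(real^'k) set"
    and g :: "real^'k \<Rightarrow> real^'l" and f :: "real^'l \<Rightarrow> real^'k"
    and M :: "real^'k^'k" and z0 :: "real^'k"
  assumes "CARD('k) < CARD('l)"
    and "g \<in> Z \<rightarrow> X" and "f \<in> X \<rightarrow> E"
    and "disjoint_mechanisms Z g"
    and "faithful_encoder Z X g f"
    and "rank M = CARD('k)"
    and "z0 \<in> Z"
    and "invertible (\<bar>M ** jacobian f (at (g z0) within X)\<bar> **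
           transpose \<bar>M ** jacobian f (at (g z0) within X)\<bar>)"
    and "diagonal_matrix (\<bar>M ** jacobian f (at (g z0) within X)\<bar> **
           transpose \<bar>M ** jacobian f (at (g z0) within X)\<bar>)"
  shows "\<exists>P S :: real^'k^'k. permutation_matrix P \<and> diagonal_matrix S \<and> invertible S \<and>
           (\<forall>z\<in>Z. M *v f (g z) = (P ** S) *v z)"
proof -
  define G where "G = jacobian g (at z0 within Z)"
  define F where "F = jacobian f (at (g z0) within X)"
  obtain D :: "real^'k^'k" where D: "rank D = CARD('k)" "\<And>z. z \<in> Z \<Longrightarrow> f (g z) = D *v z"
    using assms(5) unfolding faithful_encoder_def by blast
  have jf: "has_jacobian_at f X (g z0)" and jg: "has_jacobian_at g Z z0"
    and ker: "(span (columns G))\<^sup>\<bottom> \<subseteq> {v. F *v v = 0}"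
    using assms(5,7) unfolding faithful_encoder_def F_def G_def by blast+
  have dg: "(g has_derivative (\<lambda>h. G *v h)) (at z0 within Z)"
    using has_jacobian_at_jacobian[OF jg] G_def by blast
  have "(f has_derivative (\<lambda>h. F *v h)) (at (g z0) within X)"
    using has_jacobian_at_jacobian[OF jf] F_def by blast
  then have "(f has_derivative (\<lambda>h. F *v h)) (at (g z0) within g ` Z)"
    using assms(2) by (blast intro: has_derivative_subset)
  from has_derivative_in_compose[OF dg this]
  have FG: "((\<lambda>z. f (g z)) has_derivative (\<lambda>h. (F ** G) *v h)) (at z0 within Z)"
    by (simp add: matrix_vector_mul_assoc)
  \<comment> \<open>A second derivative of the same composite, to be compared with
    \<open>F ** G\<close>.\<close>
  have "((\<lambda>z. D *v z) has_derivative (\<lambda>h. D *v h)) (at z0 within Z)"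
    by (rule bounded_linear_imp_has_derivative) (rule matrix_vector_mul_bounded_linear)
  then have "((\<lambda>z. f (g z)) has_derivative (\<lambda>h. D *v h)) (at z0 within Z)"
    using D(2) assms(7) by (metis (no_types, lifting) has_derivative_transform)
  then have FGD: "F ** G = D"
    using has_jacobian_at_derivative_unique[OF jg FG] by blast
  have inv: "invertible (M ** D)"
    using assms(6) D(1) by (intro invertible_mult) (simp_all add: invertible_left_inverse matrix_left_invertible_injective full_rank_injective)
  have "(span (columns G))\<^sup>\<bottom> \<subseteq> {v. (M ** F) *v v = 0}"
    using ker by (auto simp flip: matrix_vector_mul_assoc)
  then obtain C where C: "M ** F = C ** transpose G"
    by (rule orthogonal_comp_column_span_subset_ker_imp_factor)
  \<comment> \<open>Disjoint columns of \<open>G\<close> are disjoint rows of its transpose, the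
    form that the criterion for rows takes.\<close>
  have "diagonal_matrix (\<bar>transpose G\<bar> ** transpose \<bar>transpose G\<bar>)"
  proof -
    have "\<bar>transpose G\<bar> = transpose \<bar>G\<bar>"
      by (simp add: vec_eq_iff abs_matrix_nth transpose_def)
    then show ?thesis
      using assms(4,7) unfolding disjoint_mechanisms_def G_def by simp
  qed
  then have G: "\<And>l j j'. j \<noteq> j' \<Longrightarrow> G $ l $ j = 0 \<or> G $ l $ j' = 0"
    unfolding diagonal_matrix_abs_mult_transpose by (simp add: transpose_def)
  have R: "\<And>i i' l. i \<noteq> i' \<Longrightarrow> (M ** F) $ i $ l = 0 \<or> (M ** F) $ i' $ l = 0"
    using assms(9) by (simp add: diagonal_matrix_abs_mult_transpose flip: F_def)
  have MD: "M ** D = (M ** F) ** G"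
    by (simp add: FGD flip: matrix_mul_assoc)
  have "\<And>i i' j. i \<noteq> i' \<Longrightarrow> (M ** D) $ i $ j = 0 \<or> (M ** D) $ i' $ j = 0"
    unfolding MD using C G R by (rule disjoint_columns_rows_mult)
  with inv obtain P S :: "real^'k^'k" where
    "permutation_matrix P" "diagonal_matrix S" "invertible S" "M ** D = P ** S"
    by (rule invertible_disjoint_rows_decomp)
  then show ?thesis
    using D(2) by (metis matrix_vector_mul_assoc)
qed

end
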